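(* Let $X$ be a (closed linear) subspace of $L_1[0,1]$. Then $X$ has property $(\mathfrak{D})$ if and only if $X$ has the Daugavet property.
   Context: All Banach spaces are real. $B_X$ and $S_X$ denote the closed unit ball and unit sphere of $X$. A slice of $B_X$ is a set of the form $S(x^*,\alpha)=\{y\in B_X:\ x^*(y)>\sup x^*(B_X)-\alpha\}$ with $x^*\in X^*$ and $\alpha>0$. For $x\in S_X$ let $D(x)=\{x^*\in S_{X^*}:\ x^*(x)=1\}$; a supporting slice at $x$ is a slice $S(x^*,\alpha)$ with $x^*\in D(x)$ and $\alpha>0$. A point $x\in S_X$ is a Daugavet-point if $\sup_{y\in S}\|x-y\|=2$ for every slice $S$ of $B_X$, and a $\mathfrak{D}$-point if $\sup_{y\in S}\|x-y\|=2$ for every supporting slice $S$ at $x$. $X$ has the Daugavet property if and only if every $x\in S_X$ is a Daugavet-point; $X$ has property $(\mathfrak{D})$ if and only if every $x\in S_X$ is a $\mathfrak{D}$-point. *)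

theory Defs
  imports "HOL-Analysis.Analysis"
begin

text \<open>The space $L_1[0,1]$: Lebesgue integrable real functions on $[0,1]$, identified when
  they agree almost everywhere there. Values of a representative outside $[0,1]$ are irrelevant.\<close>

definition L1_rel :: "(real \<Rightarrow> real) \<Rightarrow> (real \<Rightarrow> real) \<Rightarrow> bool" where
  "L1_rel f g \<longleftrightarrow> integrable (lebesgue_on {0..1}) f \<and> integrable (lebesgue_on {0..1}) g \<and>
     (AE t in lebesgue_on {0..1}. f t = g t)"

quotient_type L1 = "real \<Rightarrow> real" / partial: L1_rel
proof (rule part_equivpI)
  show "\<exists>f. L1_rel f f"
    by (rule exI[of _ "\<lambda>_. 0"]) (simp add: L1_rel_def)
  show "symp L1_rel"
    by (rule sympI) (auto simp: L1_rel_def)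
  show "transp L1_rel"
    by (rule transpI) (auto simp: L1_rel_def elim: AE_mp)
qed

instantiation L1 :: real_normed_vector
begin

lift_definition zero_L1 :: L1 is "\<lambda>_. 0"
  by (simp add: L1_rel_def)

lift_definition plus_L1 :: "L1 \<Rightarrow> L1 \<Rightarrow> L1" is "\<lambda>f g t. f t + g t"
  unfolding L1_rel_def by (auto elim: AE_mp)

lift_definition minus_L1 :: "L1 \<Rightarrow> L1 \<Rightarrow> L1" is "\<lambda>f g t. f t - g t"
  unfolding L1_rel_def by (auto elim: AE_mp)

lift_definition uminus_L1 :: "L1 \<Rightarrow> L1" is "\<lambda>f t. - f t"
  unfolding L1_rel_def by (auto elim: AE_mp)

lift_definition scaleR_L1 :: "real \<Rightarrow> L1 \<Rightarrow> L1" is "\<lambda>c f t. c * f t"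
  unfolding L1_rel_def by (auto elim: AE_mp)

lift_definition norm_L1 :: "L1 \<Rightarrow> real" is "\<lambda>f. \<integral>t. \<bar>f t\<bar> \<partial>lebesgue_on {0..1}"
  unfolding L1_rel_def by (intro integral_cong_AE) (auto elim: AE_mp)

definition dist_L1 :: "L1 \<Rightarrow> L1 \<Rightarrow> real" where
  "dist_L1 f g = norm (f - g)"

definition sgn_L1 :: "L1 \<Rightarrow> L1" where
  "sgn_L1 f = inverse (norm f) *\<^sub>R f"

definition uniformity_L1 :: "(L1 \<times> L1) filter" where
  "uniformity_L1 = (INF e\<in>{0<..}. principal {(f, g). dist f g < e})"

definition open_L1 :: "L1 set \<Rightarrow> bool" where
  "open_L1 U \<longleftrightarrow> (\<forall>f\<in>U. \<forall>\<^sub>F (f', g) in uniformity. f' = f \<longrightarrow> g \<in> U)"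

instance
proof
  fix f g h :: L1 and a b :: real
  show "f + g + h = f + (g + h)"
    by transfer (auto simp: L1_rel_def)
  show "f + g = g + f"
    by transfer (auto simp: L1_rel_def)
  show "0 + f = f"
    by transfer (auto simp: L1_rel_def)
  show "- f + f = 0"
    by transfer (auto simp: L1_rel_def)
  show "f - g = f + - g"
    by transfer (auto simp: L1_rel_def)
  show "a *\<^sub>R (f + g) = a *\<^sub>R f + a *\<^sub>R g"
    by transfer (auto simp: L1_rel_def algebra_simps)
  show "(a + b) *\<^sub>R f = a *\<^sub>R f + b *\<^sub>R f"
    by transfer (auto simp: L1_rel_def algebra_simps)
  show "a *\<^sub>R b *\<^sub>R f = (a * b) *\<^sub>R f"
    by transfer (auto simp: L1_rel_def algebra_simps)
  show "1 *\<^sub>R f = f"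
    by transfer (auto simp: L1_rel_def)
  show "dist f g = norm (f - g)"
    by (fact dist_L1_def)
  show "sgn f = inverse (norm f) *\<^sub>R f"
    by (fact sgn_L1_def)
  show "uniformity = (INF e\<in>{0<..}. principal {(f, g :: L1). dist f g < e})"
    by (fact uniformity_L1_def)
  show "open U = (\<forall>f\<in>U. \<forall>\<^sub>F (f', g) in uniformity. f' = f \<longrightarrow> g \<in> U)" for U :: "L1 set"
    by (fact open_L1_def)
  show "norm f = 0 \<longleftrightarrow> f = 0"
    by transfer (auto simp: L1_rel_def integral_nonneg_eq_0_iff_AE)
  show "norm (f + g) \<le> norm f + norm g"
  proof transfer
    fix f g assume "L1_rel f f" and "L1_rel g g"
    then have i: "integrable (lebesgue_on {0..1}) f" "integrable (lebesgue_on {0..1}) g"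
      by (auto simp: L1_rel_def)
    then have "(\<integral>t. \<bar>f t + g t\<bar> \<partial>lebesgue_on {0..1})
        \<le> (\<integral>t. \<bar>f t\<bar> + \<bar>g t\<bar> \<partial>lebesgue_on {0..1})"
      by (intro integral_mono) auto
    with i show "(\<integral>t. \<bar>f t + g t\<bar> \<partial>lebesgue_on {0..1})
        \<le> (\<integral>t. \<bar>f t\<bar> \<partial>lebesgue_on {0..1}) + (\<integral>t. \<bar>g t\<bar> \<partial>lebesgue_on {0..1})"
      by simp
  qed
  show "norm (a *\<^sub>R f) = \<bar>a\<bar> * norm f"
    by transfer (auto simp: abs_mult)
qed

end

text \<open>The following notions concern a linear subspace \<open>X\<close> of a normed space, regarded as a
  normed space of its own.\<close>

definition unit_ball :: "'a::real_normed_vector set \<Rightarrow> 'a set" where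
  "unit_ball X = {x \<in> X. norm x \<le> 1}"

definition unit_sphere :: "'a::real_normed_vector set \<Rightarrow> 'a set" where
  "unit_sphere X = {x \<in> X. norm x = 1}"

text \<open>Elements of $X^*$ are represented by functions on the ambient space of which only the
  values on \<open>X\<close> matter; no linearity or continuity is required off \<open>X\<close>.\<close>

definition dual :: "'a::real_normed_vector set \<Rightarrow> ('a \<Rightarrow> real) set" where
  "dual X = {\<phi>. (\<forall>x\<in>X. \<forall>y\<in>X. \<phi> (x + y) = \<phi> x + \<phi> y) \<and>
                (\<forall>c. \<forall>x\<in>X. \<phi> (c *\<^sub>R x) = c * \<phi> x) \<and>
                (\<exists>K. \<forall>x\<in>X. \<bar>\<phi> x\<bar> \<le> K * norm x)}"

definition dual_norm :: "'a::real_normed_vector set \<Rightarrow> ('a \<Rightarrow> real) \<Rightarrow> real" where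
  "dual_norm X \<phi> = (SUP x\<in>unit_ball X. \<bar>\<phi> x\<bar>)"

definition slice :: "'a::real_normed_vector set \<Rightarrow> ('a \<Rightarrow> real) \<Rightarrow> real \<Rightarrow> 'a set" where
  "slice X \<phi> \<alpha> = {y \<in> unit_ball X. \<phi> y > (SUP z\<in>unit_ball X. \<phi> z) - \<alpha>}"

definition supporting_functionals :: "'a::real_normed_vector set \<Rightarrow> 'a \<Rightarrow> ('a \<Rightarrow> real) set" where
  "supporting_functionals X x = {\<phi> \<in> dual X. dual_norm X \<phi> = 1 \<and> \<phi> x = 1}"

text \<open>For $\alpha > 0$ a slice is a nonempty subset of the unit ball, so the real suprema below are
  genuine ones. The Daugavet property and property $(\mathfrak{D})$ are taken in their pointwise
  form rather than through norms of operators.\<close>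

definition Daugavet_point :: "'a::real_normed_vector set \<Rightarrow> 'a \<Rightarrow> bool" where
  "Daugavet_point X x \<longleftrightarrow> x \<in> unit_sphere X \<and>
     (\<forall>\<phi>\<in>dual X. \<forall>\<alpha>>0. (SUP y\<in>slice X \<phi> \<alpha>. norm (x - y)) = 2)"

definition D_point :: "'a::real_normed_vector set \<Rightarrow> 'a \<Rightarrow> bool" where
  "D_point X x \<longleftrightarrow> x \<in> unit_sphere X \<and>
     (\<forall>\<phi>\<in>supporting_functionals X x. \<forall>\<alpha>>0. (SUP y\<in>slice X \<phi> \<alpha>. norm (x - y)) = 2)"

definition Daugavet_property :: "'a::real_normed_vector set \<Rightarrow> bool" where
  "Daugavet_property X \<longleftrightarrow> (\<forall>x\<in>unit_sphere X. Daugavet_point X x)"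

definition property_D :: "'a::real_normed_vector set \<Rightarrow> bool" where
  "property_D X \<longleftrightarrow> (\<forall>x\<in>unit_sphere X. D_point X x)"

end

theory Submission
  imports Defs
begin

text \<open>Daugavet-points are trivially $\mathfrak{D}$-points, so only one direction has content. The
  reason it holds in $L_1$ is that two functions which are almost parallel and almost opposite must live
  on almost disjoint sets. Let $x \in S_X$ be a $\mathfrak{D}$-point, and apply its definition to the functional
  $y \mapsto \int \mathrm{sgn}(x)\,y$, which supports the ball at $x$. It yields $y \in B_X$ with
  $\int \mathrm{sgn}(x)\,y$ near $1$ and $\|x - y\|$ near $2$. The first condition makes $\|x+y\|$
  near $2$ as well and puts almost all of the mass of $y$ on the support of $x$; both norms being near
  $2$ forces $\int \min(|x|,|y|)$ to be small (\<open>norm_add_norm_diff_le_overlap\<close>). On the support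
  of $x$ this makes $y$ small in measure, hence $\int \min(|z|,|y|)$ is small for
  \<^emph>\<open>every\<close> $z$ (\<open>overlap_le\<close>), and so $\|z - y\|$ is near $2$ for every $z \in S_X$
  (\<open>norm_diff_ge_overlap\<close>).

  It remains to choose $x$ so that such $y$ fall into a prescribed slice, given by a functional
  $\varphi$. If $\varphi$ attained its norm at $x$, then $\varphi(y)$ would be controlled by the
  one-sided derivative of the norm: $x - \tau y$ has norm about $1 - \tau$ for small $\tau$
  (\<open>norm_diff_scaleR_le\<close>), and $\varphi(x - \tau y) \le \|\varphi\| \|x - \tau y\|$ then makes
  $\varphi(y)$ almost $\|\varphi\|$. In general $\varphi$ need not attain its norm, but $X$ is complete, so Ekeland's
  variational principle on $S_X$ gives an almost maximal $x$ with
  $\varphi(u) \le \varphi(x) + \varepsilon \|u - x\|$ for all $u \in S_X$. Since the argument with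
  $x - \tau y$ moves $x$ by $O(\tau)$ only, the error $\varepsilon \|u - x\|$ is harmless
  (\<open>functional_ge_of_aligned\<close>). The alignment of $y$ with $x$ thus controls $\varphi(y)$ and
  $\|z - y\|$ at the same time.\<close>

section \<open>Completeness of $L_1[0,1]$\<close>

lemma L1_relI: "integrable (lebesgue_on {0..1}) f \<Longrightarrow> L1_rel f f"
  by (simp add: L1_rel_def)

lemma integrable_rep_L1: "integrable (lebesgue_on {0..1}) (rep_L1 x)"
  using Quotient_rep_reflp[OF Quotient_L1, of x] by (simp add: L1_rel_def)

lemma abs_rep_L1: "abs_L1 (rep_L1 x) = x"
  by (rule Quotient_abs_rep[OF Quotient_L1])

lemma norm_diff_abs_L1:
  assumes "integrable (lebesgue_on {0..1}) f" "integrable (lebesgue_on {0..1}) g"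
  shows "norm (abs_L1 f - abs_L1 g) = (\<integral>t. \<bar>f t - g t\<bar> \<partial>lebesgue_on {0..1})"
  using assms by (simp add: minus_L1.abs_eq norm_L1.abs_eq L1_relI)

text \<open>A Cauchy sequence in mean has a subsequence converging almost everywhere, and Fatou's lemma
  shows that the pointwise limit is also the limit in mean of the whole sequence.\<close>

lemma complete_L1: "complete (UNIV :: L1 set)"
proof (rule completeI)
  fix x :: "nat \<Rightarrow> L1"
  assume cau: "Cauchy x"
  define M where "M = lebesgue_on {0..1::real}"
  define s where "s n = rep_L1 (x n)" for n
  have int_s [measurable, simp]: "integrable M (s n)" for n
    unfolding s_def M_def by (rule integrable_rep_L1)
  have dist_s: "dist (x i) (x j) = (\<integral>t. \<bar>s i t - s j t\<bar> \<partial>M)" for i j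
    using norm_diff_abs_L1[OF integrable_rep_L1 integrable_rep_L1, of "x i" "x j"]
    by (simp add: dist_norm s_def M_def abs_rep_L1)
  obtain r where r: "strict_mono r" "AE t in M. Cauchy (\<lambda>k. s (r k) t)"
  proof (rule cauchy_L1_AE_cauchy_subseq[of M s])
    fix e :: real assume "e > 0"
    then show "\<exists>N. \<forall>i\<ge>N. \<forall>j\<ge>N. (\<integral>t. norm (s i t - s j t) \<partial>M) < e"
      using cau by (simp add: Cauchy_def dist_s)
  qed auto
  define f where "f t = lim (\<lambda>k. s (r k) t)" for t
  have f_meas [measurable]: "f \<in> borel_measurable M"
    unfolding f_def by measurable
  have lim_f: "AE t in M. (\<lambda>k. s (r k) t) \<longlonglongrightarrow> f t"
    using r(2) by eventually_elim (simp add: f_def Cauchy_convergent convergent_LIMSEQ_iff[symmetric])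
  \<comment> \<open>Fatou's lemma transfers the Cauchy bound to the pointwise limit, which is thereby integrable.\<close>
  have fatou: "(\<integral>\<^sup>+t. norm (s n t - f t) \<partial>M) \<le> ennreal e"
    if N: "\<forall>i\<ge>N. \<forall>j\<ge>N. dist (x i) (x j) < e" and n: "n \<ge> N" for n N e
  proof -
    have "(\<integral>\<^sup>+t. norm (s n t - f t) \<partial>M) = (\<integral>\<^sup>+t. liminf (\<lambda>k. ennreal (norm (s n t - s (r k) t))) \<partial>M)"
    proof (rule nn_integral_cong_AE)
      show "AE t in M. ennreal (norm (s n t - f t)) = liminf (\<lambda>k. ennreal (norm (s n t - s (r k) t)))"
        using lim_f
      proof eventually_elim
        case (elim t)
        have "(\<lambda>k. ennreal (norm (s n t - s (r k) t))) \<longlonglongrightarrow> ennreal (norm (s n t - f t))"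
          by (intro tendsto_ennrealI tendsto_intros elim)
        then show ?case
          using lim_imp_Liminf[OF sequentially_bot] by metis
      qed
    qed
    also have "\<dots> \<le> liminf (\<lambda>k. \<integral>\<^sup>+t. norm (s n t - s (r k) t) \<partial>M)"
      by (rule nn_integral_liminf) measurable
    also have "\<dots> \<le> ennreal e"
    proof (rule Liminf_le)
      show "\<forall>\<^sub>F k in sequentially. (\<integral>\<^sup>+t. norm (s n t - s (r k) t) \<partial>M) \<le> ennreal e"
        using eventually_ge_at_top[of N]
      proof eventually_elim
        case (elim k)
        then have "N \<le> r k"
          using seq_suble[OF r(1), of k] by linarith
        then have "(\<integral>t. norm (s n t - s (r k) t) \<partial>M) \<le> e"
          using N n by (force simp: dist_s)
        then show ?case
          by (subst nn_integral_eq_integral) (auto intro!: ennreal_leI)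
      qed
    qed simp
    finally show ?thesis .
  qed
  have int_f: "integrable M f"
  proof -
    obtain N where N: "\<forall>i\<ge>N. \<forall>j\<ge>N. dist (x i) (x j) < 1"
      using cau unfolding Cauchy_def by (metis zero_less_one)
    have "integrable M (\<lambda>t. s N t - f t)"
    proof (rule integrableI_bounded)
      show "(\<integral>\<^sup>+t. norm (s N t - f t) \<partial>M) < \<infinity>"
        using fatou[OF N, of N] by (simp add: order_le_less_trans)
    qed measurable
    then have "integrable M (\<lambda>t. s N t - (s N t - f t))"
      by (rule Bochner_Integration.integrable_diff[OF int_s])
    then show ?thesis by simp
  qed
  have dist_f: "dist (x n) (abs_L1 f) = (\<integral>t. \<bar>s n t - f t\<bar> \<partial>M)" for n
    using norm_diff_abs_L1[OF integrable_rep_L1, of f "x n"] int_f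
    by (simp add: dist_norm s_def M_def abs_rep_L1)
  have "x \<longlonglongrightarrow> abs_L1 f"
    unfolding lim_sequentially
  proof (intro allI impI)
    fix e :: real assume "e > 0"
    then obtain N where N: "\<forall>i\<ge>N. \<forall>j\<ge>N. dist (x i) (x j) < e / 2"
      using cau unfolding Cauchy_def by (metis half_gt_zero)
    have "dist (x n) (abs_L1 f) < e" if "n \<ge> N" for n
    proof -
      have "ennreal (dist (x n) (abs_L1 f)) \<le> ennreal (e / 2)"
        using fatou[OF N that] int_f by (simp add: dist_f nn_integral_eq_integral)
      with \<open>e > 0\<close> show ?thesis by simp
    qed
    then show "\<exists>N. \<forall>n\<ge>N. dist (x n) (abs_L1 f) < e" by blast
  qed
  then show "\<exists>l\<in>UNIV. x \<longlonglongrightarrow> l" by blast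
qed

section \<open>Ekeland's variational principle\<close>

text \<open>The relation \<open>f x + \<epsilon> * dist x u \<le> f u\<close> is a partial order on \<open>S\<close>. A chain that climbs
  almost as high as possible at each step has successor sets of vanishing diameter, so by completeness
  it converges to a point above the whole chain, and nothing else can lie above that point.\<close>

lemma ekeland_maximum:
  fixes f :: "'a::metric_space \<Rightarrow> real"
  assumes "complete S" and cont: "continuous_on S f" and bdd: "bdd_above (f ` S)"
    and "x0 \<in> S" and "\<epsilon> > 0"
  obtains x where "x \<in> S" "f x0 \<le> f x" "\<And>u. u \<in> S \<Longrightarrow> f u \<le> f x + \<epsilon> * dist u x"
proof -
  define T where "T x = {u \<in> S. f x + \<epsilon> * dist x u \<le> f u}" for x
  have T_refl: "x \<in> T x" if "x \<in> S" for x
    using that by (simp add: T_def)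
  have T_trans: "T u \<subseteq> T x" if "u \<in> T x" for u x
  proof
    fix w assume "w \<in> T u"
    moreover have "\<epsilon> * dist x w \<le> \<epsilon> * dist x u + \<epsilon> * dist u w"
      using \<open>\<epsilon> > 0\<close> dist_triangle[of x w u] by (simp add: distrib_left[symmetric])
    ultimately show "w \<in> T x"
      using that by (auto simp: T_def)
  qed
  (* No bounded family attains its supremum in general; step n is optimal up to the summable
     error (1/2)^n, which is what makes the chain Cauchy. *)
  have next_point: "\<exists>v\<in>T x. \<forall>u\<in>T x. f u \<le> f v + (1/2) ^ n" if "x \<in> S" for x n
  proof -
    have ne: "f ` T x \<noteq> {}" and b: "bdd_above (f ` T x)"
      using T_refl[OF that] by (auto intro!: bdd_above_mono[OF bdd] simp: T_def)
    have "Sup (f ` T x) - (1/2) ^ n < Sup (f ` T x)" by simp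
    then obtain v where "v \<in> T x" "Sup (f ` T x) - (1/2) ^ n < f v"
      using less_cSup_iff[OF ne b] by blast
    moreover have "f u \<le> Sup (f ` T x)" if "u \<in> T x" for u
      using that b by (intro cSup_upper) auto
    ultimately show ?thesis by (intro bexI[of _ v]) force+
  qed
  obtain x where x: "x 0 = x0" "\<And>n. x n \<in> S"
    and x_Suc: "\<And>n. x (Suc n) \<in> T (x n)" "\<And>n u. u \<in> T (x n) \<Longrightarrow> f u \<le> f (x (Suc n)) + (1/2) ^ n"
  proof -
    have "\<exists>x. \<forall>n. (x n \<in> S \<and> (n = 0 \<longrightarrow> x n = x0)) \<and>
        (x (Suc n) \<in> T (x n) \<and> (\<forall>u\<in>T (x n). f u \<le> f (x (Suc n)) + (1/2) ^ n))"
    proof (rule dependent_nat_choice)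
      fix y n assume "y \<in> S \<and> ((n::nat) = 0 \<longrightarrow> y = x0)"
      then show "\<exists>v. (v \<in> S \<and> (Suc n = 0 \<longrightarrow> v = x0)) \<and>
          (v \<in> T y \<and> (\<forall>u\<in>T y. f u \<le> f v + (1/2) ^ n))"
        using next_point[of y n] by (auto simp: T_def)
    qed (use \<open>x0 \<in> S\<close> in auto)
    then show thesis using that by metis
  qed
  have mono: "x m \<in> T (x n)" if "n \<le> m" for n m
    using that
  proof (induction rule: dec_induct)
    case base then show ?case by (rule T_refl[OF x(2)])
  next
    case (step m) then show ?case using T_trans x_Suc(1) by blast
  qed
  have close: "\<epsilon> * dist (x (Suc n)) u \<le> (1/2) ^ n" if "u \<in> T (x (Suc n))" for n u
    using that x_Suc(2)[of u n] T_trans[OF x_Suc(1)[of n]] by (auto simp: T_def)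
  have small: "\<exists>n. (1/2) ^ n < \<epsilon> * e" if "e > 0" for e
    using that \<open>\<epsilon> > 0\<close> by (intro real_arch_pow_inv) auto
  have "Cauchy x"
  proof (rule metric_CauchyI)
    fix e :: real assume "e > 0"
    then obtain n where n: "(1/2) ^ n < \<epsilon> * (e / 2)" using small[of "e/2"] by auto
    have d: "dist (x (Suc n)) (x i) < e / 2" if "i \<ge> Suc n" for i
      using close[OF mono[OF that]] n \<open>\<epsilon> > 0\<close> mult_less_cancel_left_pos order_le_less_trans by blast
    have "dist (x i) (x j) < e" if "i \<ge> Suc n" "j \<ge> Suc n" for i j
      using dist_triangle3[of "x i" "x j" "x (Suc n)"] d[OF that(1)] d[OF that(2)] by linarith
    then show "\<exists>N. \<forall>m\<ge>N. \<forall>n\<ge>N. dist (x m) (x n) < e" by blast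
  qed
  then obtain l where l: "l \<in> S" "x \<longlonglongrightarrow> l"
    using \<open>complete S\<close> x(2) unfolding complete_def by blast
  have flim: "(\<lambda>m. f (x m)) \<longlonglongrightarrow> f l"
    using cont l x(2) continuous_on_sequentially[of S f] by (auto simp: comp_def)
  have l_T: "l \<in> T (x n)" for n
  proof -
    have "(\<lambda>m. f (x n) + \<epsilon> * dist (x n) (x m)) \<longlonglongrightarrow> f (x n) + \<epsilon> * dist (x n) l"
      by (intro tendsto_intros l)
    then have "f (x n) + \<epsilon> * dist (x n) l \<le> f l"
      by (rule LIMSEQ_le[OF _ flim]) (use mono in \<open>auto simp: T_def intro!: exI[of _ n]\<close>)
    then show ?thesis using l(1) by (simp add: T_def)
  qed
  show thesis
  proof (rule that[OF l(1)])
    have "0 \<le> \<epsilon> * dist x0 l" using \<open>\<epsilon> > 0\<close> by simp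
    then show "f x0 \<le> f l"
      using l_T[of 0] unfolding T_def x(1) by simp
    fix u assume "u \<in> S"
    show "f u \<le> f l + \<epsilon> * dist u l"
    proof (rule ccontr)
      assume neg: "\<not> ?thesis"
      then have "u \<in> T l" using \<open>u \<in> S\<close> by (simp add: T_def dist_commute)
      then have uT: "u \<in> T (x n)" for n using T_trans[OF l_T] by blast
      have "u \<noteq> l" using neg by auto
      then obtain n where n: "(1/2) ^ n < \<epsilon> * (dist u l / 2)"
        using small[of "dist u l / 2"] by auto
      have "\<epsilon> * dist u l \<le> \<epsilon> * dist (x (Suc n)) u + \<epsilon> * dist (x (Suc n)) l"
        using \<open>\<epsilon> > 0\<close> dist_triangle3[of u l "x (Suc n)"] by (simp add: distrib_left[symmetric])
      also have "\<dots> \<le> 2 * (1/2) ^ n"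
        using close[OF uT, of n] close[OF l_T, of n] by simp
      finally show False using n by simp
    qed
  qed
qed

section \<open>Signs, overlaps and the norm of $L_1$\<close>

lemma integrable_sgn_mult:
  fixes f g :: "'a \<Rightarrow> real"
  assumes [measurable]: "f \<in> borel_measurable M" and "integrable M g"
  shows "integrable M (\<lambda>t. sgn (f t) * g t)"
proof (rule Bochner_Integration.integrable_bound[OF assms(2)])
  show "AE t in M. norm (sgn (f t) * g t) \<le> norm (g t)"
    by (simp add: abs_mult sgn_if)
  show "(\<lambda>t. sgn (f t) * g t) \<in> borel_measurable M"
    using assms(2) by measurable
qed

lemma integrable_min_abs:
  fixes f g :: "'a \<Rightarrow> real"
  assumes "integrable M f" "integrable M g"
  shows "integrable M (\<lambda>t. min \<bar>f t\<bar> \<bar>g t\<bar>)"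
  using assms by (intro integrable_min integrable_abs)

text \<open>Where \<open>f \<noteq> 0\<close>, one has \<open>\<bar>h\<bar> \<le> k * \<bar>f\<bar>\<close> up to an excess whose integral vanishes as $k \to \infty$;
  where \<open>f = 0\<close>, the integrand \<open>\<bar>g\<bar> - sgn f * g\<close> equals \<open>\<bar>g\<bar>\<close> and pays for everything. The point
  is that \<open>k\<close> does not depend on \<open>g\<close>.\<close>

lemma integral_min_abs_le:
  fixes f h :: "'a \<Rightarrow> real"
  assumes f: "integrable M f" and h: "integrable M h" and "\<eta> > 0"
  shows "\<exists>k\<ge>0. \<forall>g :: 'a \<Rightarrow> real. integrable M g \<longrightarrow>
    (\<integral>t. min \<bar>h t\<bar> \<bar>g t\<bar> \<partial>M) \<le>
      \<eta> + k * (\<integral>t. min \<bar>f t\<bar> \<bar>g t\<bar> \<partial>M) + ((\<integral>t. \<bar>g t\<bar> \<partial>M) - (\<integral>t. sgn (f t) * g t \<partial>M))"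
proof -
  note [measurable] = borel_measurable_integrable[OF f] borel_measurable_integrable[OF h]
  (* The excess of |h| over a multiple of |f| on the support of f. The factor Suc n, being at
     least 1, may be pulled out of min (k * |f|) |g|. *)
  define a where "a n t = (if f t = 0 then 0 else max 0 (\<bar>h t\<bar> - real (Suc n) * \<bar>f t\<bar>))" for n t
  have [measurable]: "a n \<in> borel_measurable M" for n
    unfolding a_def by measurable
  have bound: "AE t in M. norm (a n t) \<le> \<bar>h t\<bar>" for n
    by (simp add: a_def max_def)
  have "(\<lambda>n. \<integral>t. a n t \<partial>M) \<longlonglongrightarrow> (\<integral>t. 0 \<partial>M)"
  proof (rule integral_dominated_convergence[OF _ _ _ _ bound])
    have "(\<lambda>n. a n t) \<longlonglongrightarrow> 0" for t
    proof (cases "f t = 0")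
      case False
      then obtain N where N: "\<bar>h t\<bar> < real N * \<bar>f t\<bar>"
        using reals_Archimedean3[of "\<bar>f t\<bar>"] by auto
      have "\<forall>\<^sub>F n in sequentially. a n t = 0"
        using eventually_ge_at_top[of N]
      proof eventually_elim
        case (elim n)
        then have "real N * \<bar>f t\<bar> \<le> real (Suc n) * \<bar>f t\<bar>"
          by (intro mult_right_mono) auto
        with N show ?case unfolding a_def by simp
      qed
      then show ?thesis by (rule tendsto_eventually)
    qed (simp add: a_def)
    then show "AE t in M. (\<lambda>n. a n t) \<longlonglongrightarrow> 0" by simp
  qed (use h in auto)
  then have "\<forall>\<^sub>F n in sequentially. (\<integral>t. a n t \<partial>M) < \<eta>"
    using \<open>\<eta> > 0\<close> by (intro order_tendstoD) auto
  then obtain n where n: "(\<integral>t. a n t \<partial>M) < \<eta>"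
    by (auto simp: eventually_sequentially)
  define k where "k = real (Suc n)"
  have "k \<ge> 1" by (simp add: k_def)
  have int_a: "integrable M (a n)"
    by (rule Bochner_Integration.integrable_bound[OF integrable_abs[OF h]]) (use bound in auto)
  show ?thesis
  proof (intro exI[of _ k] conjI allI impI)
    show "k \<ge> 0" using \<open>k \<ge> 1\<close> by simp
    fix g :: "'a \<Rightarrow> real" assume g: "integrable M g"
    have pointwise: "min \<bar>h t\<bar> \<bar>g t\<bar> \<le> a n t + k * min \<bar>f t\<bar> \<bar>g t\<bar> + (\<bar>g t\<bar> - sgn (f t) * g t)" for t
    proof (cases "f t = 0")
      case True then show ?thesis by (simp add: a_def)
    next
      case False
      have 1: "\<bar>h t\<bar> \<le> a n t + k * \<bar>f t\<bar>" "0 \<le> a n t"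
        using False by (auto simp: a_def k_def)
      have 2: "min (k * \<bar>f t\<bar>) \<bar>g t\<bar> \<le> k * min \<bar>f t\<bar> \<bar>g t\<bar>"
        using mult_right_mono[OF \<open>k \<ge> 1\<close>, of "\<bar>g t\<bar>"] by (auto simp: min_def)
      have 3: "sgn (f t) * g t \<le> \<bar>g t\<bar>"
        by (auto simp: sgn_if)
      have "min H G \<le> a' + m + (G - p)"
        if "H \<le> a' + F" "0 \<le> a'" "min F G \<le> m" "p \<le> G" for H G F a' m p :: real
        using that by (auto simp: min_def split: if_splits)
      from this[OF 1 2 3] show ?thesis .
    qed
    note ints = int_a integrable_min_abs[OF f g] integrable_abs[OF g] integrable_sgn_mult[OF _ g, of f]
    have "(\<integral>t. min \<bar>h t\<bar> \<bar>g t\<bar> \<partial>M) \<le>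
        (\<integral>t. a n t + k * min \<bar>f t\<bar> \<bar>g t\<bar> + (\<bar>g t\<bar> - sgn (f t) * g t) \<partial>M)"
      by (intro integral_mono integrable_min_abs h g pointwise Bochner_Integration.integrable_add
          Bochner_Integration.integrable_diff integrable_mult_right ints) measurable
    also have "\<dots> = (\<integral>t. a n t \<partial>M) + k * (\<integral>t. min \<bar>f t\<bar> \<bar>g t\<bar> \<partial>M)
        + ((\<integral>t. \<bar>g t\<bar> \<partial>M) - (\<integral>t. sgn (f t) * g t \<partial>M))"
      using ints by simp
    finally show "(\<integral>t. min \<bar>h t\<bar> \<bar>g t\<bar> \<partial>M) \<le>
      \<eta> + k * (\<integral>t. min \<bar>f t\<bar> \<bar>g t\<bar> \<partial>M) + ((\<integral>t. \<bar>g t\<bar> \<partial>M) - (\<integral>t. sgn (f t) * g t \<partial>M))"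
      using n by linarith
  qed
qed

text \<open>The one-sided derivative of the $L_1$-norm at \<open>f\<close> in direction \<open>- g\<close> is
  $-\int \mathrm{sgn}(f)\,g + \int_{f = 0} |g|$, and the last integral is at most
  $\int |g| - \int \mathrm{sgn}(f)\,g$. The bound is the resulting first-order expansion.\<close>

lemma integral_abs_diff_le:
  fixes f g :: "'a \<Rightarrow> real"
  assumes f: "integrable M f" and g: "integrable M g" and "\<delta> > 0"
  shows "\<exists>\<tau>>0. \<tau> < 1 \<and> (\<integral>t. \<bar>f t - \<tau> * g t\<bar> \<partial>M) \<le>
    (\<integral>t. \<bar>f t\<bar> \<partial>M) - \<tau> * (2 * (\<integral>t. sgn (f t) * g t \<partial>M) - (\<integral>t. \<bar>g t\<bar> \<partial>M)) + \<tau> * \<delta>"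
proof -
  note [measurable] = borel_measurable_integrable[OF f] borel_measurable_integrable[OF g]
  define c where "c n = 1 / (2 + real n)" for n :: nat
  have c: "0 < c n" "c n < 1" for n by (auto simp: c_def)
  (* The positive part of the error made by the claimed slope in the difference quotient with step
     c n. At each point it vanishes for all large n. *)
  define r where
    "r n t = max 0 ((\<bar>f t - c n * g t\<bar> - \<bar>f t\<bar>) / c n - (\<bar>g t\<bar> - 2 * (sgn (f t) * g t)))" for n t
  have [measurable]: "r n \<in> borel_measurable M" for n
    unfolding r_def by measurable
  have sg: "\<bar>sgn (f t) * g t\<bar> \<le> \<bar>g t\<bar>" for t
    by (simp add: abs_mult sgn_if)
  have bound: "AE t in M. norm (r n t) \<le> 4 * \<bar>g t\<bar>" for n
  proof (rule AE_I2)
    fix t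
    have "\<bar>f t - c n * g t\<bar> - \<bar>f t\<bar> \<le> \<bar>g t\<bar> * c n"
      using abs_triangle_ineq4[of "f t" "c n * g t"] c(1)[of n] by (simp add: abs_mult mult.commute)
    then have "(\<bar>f t - c n * g t\<bar> - \<bar>f t\<bar>) / c n \<le> \<bar>g t\<bar>"
      using c(1)[of n] by (simp add: pos_divide_le_eq)
    moreover have "\<bar>max 0 (q - (G - 2 * p))\<bar> \<le> 4 * G" if "q \<le> G" "\<bar>p\<bar> \<le> G" for q p G :: real
      using that by linarith
    ultimately show "norm (r n t) \<le> 4 * \<bar>g t\<bar>"
      using sg[of t] unfolding r_def real_norm_def by blast
  qed
  have "(\<lambda>n. \<integral>t. r n t \<partial>M) \<longlonglongrightarrow> (\<integral>t. 0 \<partial>M)"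
  proof (rule integral_dominated_convergence[OF _ _ _ _ bound])
    have "(\<lambda>n. r n t) \<longlonglongrightarrow> 0" for t
    proof (cases "f t = 0")
      case True
      then have "r n t = 0" for n
        using c(1)[of n] by (simp add: r_def abs_mult)
      then show ?thesis by simp
    next
      case False
      then obtain N where N: "\<bar>g t\<bar> < real N * \<bar>f t\<bar>"
        using reals_Archimedean3[of "\<bar>f t\<bar>"] by auto
      have "\<forall>\<^sub>F n in sequentially. r n t = 0"
        using eventually_ge_at_top[of N]
      proof eventually_elim
        case (elim n)
        then have "real N * \<bar>f t\<bar> \<le> (2 + real n) * \<bar>f t\<bar>"
          by (intro mult_right_mono) auto
        with N have "\<bar>g t\<bar> < (2 + real n) * \<bar>f t\<bar>" by linarith
        then have "\<bar>c n * g t\<bar> < \<bar>f t\<bar>"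
          by (simp add: c_def abs_mult divide_simps mult.commute)
        then have "\<bar>f t - c n * g t\<bar> - \<bar>f t\<bar> = c n * (- (sgn (f t) * g t))"
          using False by (cases "f t > 0") (simp_all add: sgn_if)
        then have "(\<bar>f t - c n * g t\<bar> - \<bar>f t\<bar>) / c n = - (sgn (f t) * g t)"
          using c(1)[of n] by simp
        moreover have "sgn (f t) * g t \<le> \<bar>g t\<bar>"
          using abs_le_D1[OF sg] .
        ultimately show ?case unfolding r_def by (simp add: max_def mult.commute)
      qed
      then show ?thesis by (rule tendsto_eventually)
    qed
    then show "AE t in M. (\<lambda>n. r n t) \<longlonglongrightarrow> 0" by simp
  qed (use g in auto)
  then have "\<forall>\<^sub>F n in sequentially. (\<integral>t. r n t \<partial>M) < \<delta>"
    using \<open>\<delta> > 0\<close> by (intro order_tendstoD) auto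
  then obtain n where n: "(\<integral>t. r n t \<partial>M) < \<delta>"
    by (auto simp: eventually_sequentially)
  have int_r: "integrable M (r n)"
    by (rule Bochner_Integration.integrable_bound[of _ "\<lambda>t. 4 * \<bar>g t\<bar>"]) (use bound g in auto)
  have pointwise: "\<bar>f t - c n * g t\<bar> \<le> \<bar>f t\<bar> + c n * (r n t + (\<bar>g t\<bar> - 2 * (sgn (f t) * g t)))" for t
  proof -
    have "(\<bar>f t - c n * g t\<bar> - \<bar>f t\<bar>) / c n \<le> r n t + (\<bar>g t\<bar> - 2 * (sgn (f t) * g t))"
      unfolding r_def by (simp add: max_def)
    then show ?thesis
      using c(1)[of n] by (simp add: pos_divide_le_eq mult.commute)
  qed
  note ints = int_r integrable_abs[OF f] integrable_abs[OF g] integrable_sgn_mult[OF _ g, of f]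
  have "(\<integral>t. \<bar>f t - c n * g t\<bar> \<partial>M) \<le>
      (\<integral>t. \<bar>f t\<bar> + c n * (r n t + (\<bar>g t\<bar> - 2 * (sgn (f t) * g t))) \<partial>M)"
    by (intro integral_mono pointwise) (use ints f g in auto)
  also have "\<dots> = (\<integral>t. \<bar>f t\<bar> \<partial>M) + c n * ((\<integral>t. r n t \<partial>M) +
      ((\<integral>t. \<bar>g t\<bar> \<partial>M) - 2 * (\<integral>t. sgn (f t) * g t \<partial>M)))"
    using ints by simp
  also have "\<dots> \<le> (\<integral>t. \<bar>f t\<bar> \<partial>M) + c n * (\<delta> +
      ((\<integral>t. \<bar>g t\<bar> \<partial>M) - 2 * (\<integral>t. sgn (f t) * g t \<partial>M)))"
    using n c(1)[of n] by (intro add_left_mono mult_left_mono add_right_mono) auto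
  finally show ?thesis
    using c[of n] by (intro exI[of _ "c n"]) (auto simp: algebra_simps)
qed

lift_definition sign_pairing :: "L1 \<Rightarrow> L1 \<Rightarrow> real"
  is "\<lambda>f g. \<integral>t. sgn (f t) * g t \<partial>lebesgue_on {0..1}"
  unfolding L1_rel_def
  by (intro integral_cong_AE borel_measurable_integrable[OF integrable_sgn_mult]) (auto elim: AE_mp)

lift_definition overlap :: "L1 \<Rightarrow> L1 \<Rightarrow> real"
  is "\<lambda>f g. \<integral>t. min \<bar>f t\<bar> \<bar>g t\<bar> \<partial>lebesgue_on {0..1}"
  unfolding L1_rel_def
  by (intro integral_cong_AE borel_measurable_integrable[OF integrable_min_abs]) (auto elim: AE_mp)

lemma sign_pairing_add: "sign_pairing x (y + z) = sign_pairing x y + sign_pairing x z"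
  by transfer (simp add: L1_rel_def distrib_left integrable_sgn_mult)

lemma sign_pairing_scaleR: "sign_pairing x (c *\<^sub>R y) = c * sign_pairing x y"
  by transfer (simp add: ac_simps flip: integral_mult_right_zero)

lemma sign_pairing_self: "sign_pairing x x = norm x"
  by transfer (simp add: abs_sgn mult.commute)

lemma abs_sign_pairing_le: "\<bar>sign_pairing x y\<bar> \<le> norm y"
proof transfer
  fix f g assume "L1_rel f f" "L1_rel g g"
  then have "integrable (lebesgue_on {0..1}) g" "f \<in> borel_measurable (lebesgue_on {0..1})"
    by (auto simp: L1_rel_def)
  then have "(\<integral>t. \<bar>sgn (f t) * g t\<bar> \<partial>lebesgue_on {0..1}) \<le> (\<integral>t. \<bar>g t\<bar> \<partial>lebesgue_on {0..1})"
    by (intro integral_mono integrable_abs integrable_sgn_mult) (auto simp: abs_mult abs_sgn_eq)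
  then show "\<bar>\<integral>t. sgn (f t) * g t \<partial>lebesgue_on {0..1}\<bar> \<le> (\<integral>t. \<bar>g t\<bar> \<partial>lebesgue_on {0..1})"
    by (rule order_trans[OF integral_abs_bound])
qed

text \<open>The next two estimates integrate the pointwise facts that one of \<open>\<bar>a + b\<bar>\<close>, \<open>\<bar>a - b\<bar>\<close> equals
  \<open>\<bar>a\<bar> + \<bar>b\<bar>\<close> and the other one \<open>\<bar>a\<bar> + \<bar>b\<bar> - 2 * min \<bar>a\<bar> \<bar>b\<bar>\<close>. Hence a small overlap
  makes two functions almost opposite, and two functions that are almost opposite and almost
  parallel have a small overlap.\<close>

lemma norm_diff_ge_overlap: "norm x + norm y - 2 * overlap x y \<le> norm (x - y)"
proof transfer
  fix f g assume "L1_rel f f" "L1_rel g g"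
  then have i: "integrable (lebesgue_on {0..1}) f" "integrable (lebesgue_on {0..1}) g"
    by (auto simp: L1_rel_def)
  then have "(\<integral>t. \<bar>f t\<bar> + \<bar>g t\<bar> - 2 * min \<bar>f t\<bar> \<bar>g t\<bar> \<partial>lebesgue_on {0..1})
      \<le> (\<integral>t. \<bar>f t - g t\<bar> \<partial>lebesgue_on {0..1})"
    by (intro integral_mono) (auto intro!: integrable_min_abs)
  with i show "(\<integral>t. \<bar>f t\<bar> \<partial>lebesgue_on {0..1}) + (\<integral>t. \<bar>g t\<bar> \<partial>lebesgue_on {0..1})
      - 2 * (\<integral>t. min \<bar>f t\<bar> \<bar>g t\<bar> \<partial>lebesgue_on {0..1}) \<le> (\<integral>t. \<bar>f t - g t\<bar> \<partial>lebesgue_on {0..1})"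
    by (simp add: integrable_min_abs)
qed

lemma norm_add_norm_diff_le_overlap:
  "norm (x + y) + norm (x - y) + 2 * overlap x y \<le> 2 * norm x + 2 * norm y"
proof transfer
  fix f g assume "L1_rel f f" "L1_rel g g"
  then have i: "integrable (lebesgue_on {0..1}) f" "integrable (lebesgue_on {0..1}) g"
    by (auto simp: L1_rel_def)
  then have "(\<integral>t. \<bar>f t + g t\<bar> + \<bar>f t - g t\<bar> + 2 * min \<bar>f t\<bar> \<bar>g t\<bar> \<partial>lebesgue_on {0..1})
      \<le> (\<integral>t. 2 * \<bar>f t\<bar> + 2 * \<bar>g t\<bar> \<partial>lebesgue_on {0..1})"
    by (intro integral_mono) (auto intro!: integrable_min_abs)
  with i show "(\<integral>t. \<bar>f t + g t\<bar> \<partial>lebesgue_on {0..1}) + (\<integral>t. \<bar>f t - g t\<bar> \<partial>lebesgue_on {0..1})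
      + 2 * (\<integral>t. min \<bar>f t\<bar> \<bar>g t\<bar> \<partial>lebesgue_on {0..1})
      \<le> 2 * (\<integral>t. \<bar>f t\<bar> \<partial>lebesgue_on {0..1}) + 2 * (\<integral>t. \<bar>g t\<bar> \<partial>lebesgue_on {0..1})"
    by (simp add: integrable_min_abs)
qed

text \<open>This is what frees the argument from \<open>x\<close>: a function aligned in sign with \<open>x\<close> that hardly
  overlaps \<open>x\<close> hardly overlaps any given \<open>z\<close>, even if \<open>z\<close> does not vanish off the support of \<open>x\<close>.\<close>

lemma overlap_le:
  assumes "\<eta> > 0"
  shows "\<exists>k\<ge>0. \<forall>y. overlap z y \<le> \<eta> + k * overlap x y + (norm y - sign_pairing x y)"
  using integral_min_abs_le[OF integrable_rep_L1[of x] integrable_rep_L1[of z] assms]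
  unfolding overlap.rep_eq sign_pairing.rep_eq norm_L1.rep_eq
  by (blast intro: integrable_rep_L1)

lemma norm_diff_scaleR_le:
  assumes "\<delta> > 0"
  shows "\<exists>\<tau>>0. \<tau> < 1 \<and>
    norm (x - \<tau> *\<^sub>R y) \<le> norm x - \<tau> * (2 * sign_pairing x y - norm y) + \<tau> * \<delta>"
  using assms
proof (transfer fixing: \<delta>)
  fix f g assume "L1_rel f f" "L1_rel g g" "\<delta> > 0"
  then show "\<exists>\<tau>>0. \<tau> < 1 \<and> (\<integral>t. \<bar>f t - \<tau> * g t\<bar> \<partial>lebesgue_on {0..1}) \<le>
      (\<integral>t. \<bar>f t\<bar> \<partial>lebesgue_on {0..1}) - \<tau> * (2 * (\<integral>t. sgn (f t) * g t \<partial>lebesgue_on {0..1})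
        - (\<integral>t. \<bar>g t\<bar> \<partial>lebesgue_on {0..1})) + \<tau> * \<delta>"
    by (intro integral_abs_diff_le) (auto simp: L1_rel_def)
qed

section \<open>The Daugavet property\<close>

lemma dual_scaleR: "\<phi> \<in> dual X \<Longrightarrow> x \<in> X \<Longrightarrow> \<phi> (c *\<^sub>R x) = c * \<phi> x"
  by (simp add: dual_def)

lemma dual_diff:
  assumes "subspace X" "\<phi> \<in> dual X" "x \<in> X" "y \<in> X"
  shows "\<phi> (x - y) = \<phi> x - \<phi> y"
proof -
  have "\<phi> (x + (-1) *\<^sub>R y) = \<phi> x + \<phi> ((-1) *\<^sub>R y)"
    using assms(2,3) subspace_scale[OF assms(1,4), of "-1"] unfolding dual_def by blast
  then show ?thesis
    using dual_scaleR[OF assms(2,4), of "-1"] by simp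
qed

lemma bdd_above_dual:
  assumes "\<phi> \<in> dual X"
  shows "bdd_above (\<phi> ` unit_ball X)"
proof -
  obtain K where K: "\<forall>x\<in>X. \<bar>\<phi> x\<bar> \<le> K * norm x"
    using assms by (auto simp: dual_def)
  have "\<phi> x \<le> \<bar>K\<bar>" if "x \<in> X" "norm x \<le> 1" for x
  proof -
    have "\<phi> x \<le> \<bar>K\<bar> * norm x"
      using K that(1) abs_ge_self[of K] mult_right_mono[of K "\<bar>K\<bar>" "norm x"] by force
    also have "\<dots> \<le> \<bar>K\<bar>" using that(2) by (simp add: mult_left_le)
    finally show ?thesis .
  qed
  then show ?thesis by (intro bdd_aboveI2[of _ _ "\<bar>K\<bar>"]) (simp add: unit_ball_def)
qed

lemma continuous_on_dual:
  assumes "subspace X" "\<phi> \<in> dual X"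
  shows "continuous_on X \<phi>"
proof -
  obtain K where K: "\<forall>x\<in>X. \<bar>\<phi> x\<bar> \<le> K * norm x"
    using assms by (auto simp: dual_def)
  have "dist (\<phi> x) (\<phi> y) \<le> \<bar>K\<bar> * dist x y" if "x \<in> X" "y \<in> X" for x y
  proof -
    have "\<phi> x - \<phi> y = \<phi> (x - y)" by (simp add: dual_diff[OF assms that])
    also have "\<bar>\<dots>\<bar> \<le> K * norm (x - y)"
      using K subspace_diff[OF assms(1) that] by blast
    also have "\<dots> \<le> \<bar>K\<bar> * norm (x - y)"
      by (simp add: mult_right_mono)
    finally show ?thesis by (simp add: dist_norm)
  qed
  then have "\<bar>K\<bar>-lipschitz_on X \<phi>" by (intro lipschitz_onI) auto
  then show ?thesis by (rule lipschitz_on_continuous_on)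
qed

lemma sign_pairing_supporting:
  assumes "x \<in> unit_sphere X"
  shows "sign_pairing x \<in> supporting_functionals X x"
proof -
  have x: "x \<in> unit_ball X" "sign_pairing x x = 1"
    using assms by (auto simp: unit_ball_def unit_sphere_def sign_pairing_self)
  have le: "\<bar>sign_pairing x y\<bar> \<le> 1" if "y \<in> unit_ball X" for y
    using abs_sign_pairing_le[of x y] that by (simp add: unit_ball_def)
  have "dual_norm X (sign_pairing x) = 1"
    unfolding dual_norm_def
    by (rule cSup_eq_maximum) (use x le in \<open>force intro: image_eqI[of _ _ x]\<close>)+
  moreover have "sign_pairing x \<in> dual X"
    unfolding dual_def using abs_sign_pairing_le[of x]
    by (auto simp: sign_pairing_add sign_pairing_scaleR intro!: exI[of _ 1])
  ultimately show ?thesis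
    using x by (simp add: supporting_functionals_def)
qed

lemma D_point_opposite:
  assumes "D_point X x" and "\<delta> > 0"
  obtains y where "y \<in> X" "norm y \<le> 1" "sign_pairing x y > 1 - \<delta>" "norm (x - y) > 2 - \<delta>"
proof -
  let ?S = "slice X (sign_pairing x) \<delta>"
  have x: "x \<in> unit_sphere X" "x \<in> unit_ball X" "sign_pairing x x = 1"
    using assms(1) by (auto simp: D_point_def unit_ball_def unit_sphere_def sign_pairing_self)
  have le: "sign_pairing x y \<le> 1" if "y \<in> unit_ball X" for y
    using abs_sign_pairing_le[of x y] that by (auto simp: unit_ball_def)
  have sup: "(SUP y\<in>unit_ball X. sign_pairing x y) = 1"
    by (rule cSup_eq_maximum) (use x le in \<open>force intro: image_eqI[of _ _ x]\<close>)+
  have "(SUP y\<in>?S. norm (x - y)) = 2"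
    using assms sign_pairing_supporting[OF x(1)] by (simp add: D_point_def)
  moreover have "x \<in> ?S"
    using x \<open>\<delta> > 0\<close> by (simp add: slice_def sup)
  moreover have "(SUP y\<in>?S. norm (x - y)) \<le> 2 - \<delta>"
    if "\<And>y. y \<in> ?S \<Longrightarrow> norm (x - y) \<le> 2 - \<delta>"
    using \<open>x \<in> ?S\<close> that by (intro cSUP_least) auto
  ultimately obtain y where "y \<in> ?S" "norm (x - y) > 2 - \<delta>"
    using \<open>\<delta> > 0\<close> by (metis not_le diff_less_eq less_add_same_cancel1 linorder_not_less)
  then show thesis
    unfolding slice_def sup by (intro that[of y]) (auto simp: unit_ball_def)
qed

text \<open>Normalizing \<open>x - \<tau> y\<close> gives a competitor \<open>u\<close> of \<open>x\<close> on the sphere. As \<open>y\<close> is aligned with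
  \<open>x\<close>, normalization gains a factor of about \<open>1 + \<tau>\<close>, and almost maximality of \<open>x\<close> forces the loss
  \<open>\<tau> * \<phi> y\<close> to compensate for that gain.\<close>

lemma functional_ge_of_aligned:
  assumes X: "subspace X" and \<phi>: "\<phi> \<in> dual X"
    and x: "x \<in> unit_sphere X" "\<phi> x \<ge> 0" and "\<epsilon> \<ge> 0"
    and ek: "\<And>u. u \<in> unit_sphere X \<Longrightarrow> \<phi> u \<le> \<phi> x + \<epsilon> * dist u x"
    and y: "y \<in> X" "norm y \<le> 1" "sign_pairing x y > 1 - \<delta>" and "\<delta> > 0"
  shows "\<phi> y \<ge> (1 - 3 * \<delta>) * \<phi> x - 2 * \<epsilon>"
proof -
  have xX: "x \<in> X" "norm x = 1" using x by (auto simp: unit_sphere_def)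
  obtain \<tau> where \<tau>: "0 < \<tau>" "\<tau> < 1"
    "norm (x - \<tau> *\<^sub>R y) \<le> norm x - \<tau> * (2 * sign_pairing x y - norm y) + \<tau> * \<delta>"
    using norm_diff_scaleR_le[OF \<open>\<delta> > 0\<close>] by blast
  define w where "w = x - \<tau> *\<^sub>R y"
  have wX: "w \<in> X" unfolding w_def using X xX y by (intro subspace_diff subspace_scale)
  have ty: "norm (\<tau> *\<^sub>R y) \<le> \<tau>" using \<tau> y by (simp add: mult_left_le)
  have "\<bar>1 - norm w\<bar> \<le> norm (\<tau> *\<^sub>R y)"
    using norm_triangle_ineq3[of x w] xX by (simp add: w_def)
  with ty have n1: "\<bar>1 - norm w\<bar> \<le> \<tau>" by linarith
  then have wpos: "norm w > 0" using \<tau> by linarith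
  have "\<tau> * (1 - 3 * \<delta>) \<le> \<tau> * (2 * sign_pairing x y - norm y - \<delta>)"
    using \<tau> y by (intro mult_left_mono) auto
  then have n2: "\<tau> * (1 - 3 * \<delta>) \<le> 1 - norm w"
    using \<tau>(3) xX by (simp add: w_def algebra_simps)
  define u where "u = (1 / norm w) *\<^sub>R w"
  have u: "u \<in> unit_sphere X"
    using wX wpos X by (simp add: u_def unit_sphere_def subspace_scale)
  have wu: "w = norm w *\<^sub>R u" using wpos by (simp add: u_def)
  have "norm w * dist u x = norm (norm w *\<^sub>R (u - x))" by (simp add: dist_norm)
  also have "norm w *\<^sub>R (u - x) = (1 - norm w) *\<^sub>R x - \<tau> *\<^sub>R y"
    unfolding scaleR_diff_right wu[symmetric] by (simp add: w_def algebra_simps)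
  also have "norm \<dots> \<le> 2 * \<tau>"
    using norm_triangle_ineq4[of "(1 - norm w) *\<^sub>R x" "\<tau> *\<^sub>R y"] n1 ty xX by simp
  finally have dist_u: "norm w * dist u x \<le> 2 * \<tau>" .
  have "u \<in> X" using u by (simp add: unit_sphere_def)
  have "\<phi> x - \<tau> * \<phi> y = \<phi> w"
    using X xX y by (simp add: w_def dual_diff[OF X \<phi>] dual_scaleR[OF \<phi>] subspace_scale)
  also have "\<dots> = norm w * \<phi> u"
    by (subst wu) (rule dual_scaleR[OF \<phi> \<open>u \<in> X\<close>])
  also have "\<dots> \<le> norm w * (\<phi> x + \<epsilon> * dist u x)"
    using ek[OF u] by (intro mult_left_mono) auto
  also have "\<dots> = norm w * \<phi> x + \<epsilon> * (norm w * dist u x)" by (simp add: algebra_simps)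
  also have "\<dots> \<le> norm w * \<phi> x + \<epsilon> * (2 * \<tau>)"
    using dist_u \<open>\<epsilon> \<ge> 0\<close> by (intro add_left_mono mult_left_mono)
  finally have "(1 - norm w) * \<phi> x - 2 * \<epsilon> * \<tau> \<le> \<tau> * \<phi> y" by (simp add: algebra_simps)
  moreover have "\<tau> * (1 - 3 * \<delta>) * \<phi> x \<le> (1 - norm w) * \<phi> x"
    using n2 x(2) by (intro mult_right_mono)
  ultimately have "\<tau> * ((1 - 3 * \<delta>) * \<phi> x - 2 * \<epsilon>) \<le> \<tau> * \<phi> y" by (simp add: algebra_simps)
  then show ?thesis using \<tau> by simp
qed

text \<open>The supremum of a functional over the ball is approached on the sphere. A point \<open>z\<close> of the
  sphere is given because \<open>X\<close> might be trivial.\<close>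

lemma almost_maximal_on_sphere:
  assumes X: "subspace X" and \<phi>: "\<phi> \<in> dual X" and z: "z \<in> unit_sphere X" and "\<epsilon> > 0"
  obtains x where "x \<in> unit_sphere X" "\<phi> x \<ge> 0" "\<phi> x > (SUP y\<in>unit_ball X. \<phi> y) - \<epsilon>"
proof -
  let ?m = "SUP y\<in>unit_ball X. \<phi> y"
  have lin: "\<phi> (c *\<^sub>R v) = c * \<phi> v" if "v \<in> X" for c v
    by (rule dual_scaleR[OF \<phi> that])
  have "unit_ball X \<noteq> {}" using z by (auto simp: unit_ball_def unit_sphere_def)
  then have "\<exists>v\<in>unit_ball X. ?m - \<epsilon> < \<phi> v"
    using \<open>\<epsilon> > 0\<close> less_cSUP_iff[OF _ bdd_above_dual[OF \<phi>], of "?m - \<epsilon>"] by simp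
  then obtain v where v: "v \<in> X" "norm v \<le> 1" "?m - \<epsilon> < \<phi> v"
    by (auto simp: unit_ball_def)
  show thesis
  proof (cases "\<phi> v > 0")
    case True
    then have "v \<noteq> 0" using lin[OF v(1), of 0] by auto
    have "\<phi> v \<le> \<phi> v / norm v"
      using True v \<open>v \<noteq> 0\<close> by (simp add: pos_le_divide_eq mult_left_le)
    then show thesis
      using v True \<open>v \<noteq> 0\<close> X lin[OF v(1)]
      by (intro that[of "(1 / norm v) *\<^sub>R v"]) (auto simp: unit_sphere_def subspace_scale)
  next
    case False
    (* A nonpositive value is already close to the supremum, so any point of the sphere at which the
       functional is nonnegative will do. *)
    define x where "x = (if \<phi> z \<ge> 0 then 1 else -1 :: real) *\<^sub>R z"
    have "x \<in> unit_sphere X" "\<phi> x \<ge> 0"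
      using z X lin[of z] by (auto simp: x_def unit_sphere_def subspace_neg lin[of z "-1", simplified])
    then show thesis using that[of x] v False by linarith
  qed
qed

text \<open>Ekeland's principle provides the base point \<open>x\<close>, and the point that the $\mathfrak{D}$-property of
  \<open>x\<close> provides for its sign functional serves for \<open>\<phi>\<close> and \<open>z\<close> simultaneously.\<close>

lemma opposite_point_in_slice:
  fixes X :: "L1 set"
  assumes X: "subspace X" "closed X" and D: "property_D X" and z: "z \<in> unit_sphere X"
    and \<phi>: "\<phi> \<in> dual X" and "\<alpha> > 0" "e > 0"
  obtains y where "y \<in> slice X \<phi> \<alpha>" "norm (z - y) > 2 - e"
proof -
  define m where "m = (SUP y\<in>unit_ball X. \<phi> y)"
  define \<epsilon> where "\<epsilon> = \<alpha> / 6"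
  have "\<epsilon> > 0" using \<open>\<alpha> > 0\<close> by (simp add: \<epsilon>_def)
  obtain x0 where x0: "x0 \<in> unit_sphere X" "\<phi> x0 \<ge> 0" "\<phi> x0 > m - \<epsilon>"
    using almost_maximal_on_sphere[OF X(1) \<phi> z \<open>\<epsilon> > 0\<close>] unfolding m_def by blast
  have sphere: "unit_sphere X = X \<inter> {x. norm x = 1}"
    by (auto simp: unit_sphere_def)
  have "closed {x :: L1. norm x = 1}"
    by (intro closed_Collect_eq continuous_intros)
  then have "complete (unit_sphere X)"
    unfolding sphere using X(2) by (intro complete_closed_subset[OF _ _ complete_L1] closed_Int) auto
  moreover have "continuous_on (unit_sphere X) \<phi>"
    using continuous_on_dual[OF X(1) \<phi>] by (rule continuous_on_subset) (auto simp: unit_sphere_def)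
  moreover have "bdd_above (\<phi> ` unit_sphere X)"
    by (rule bdd_above_mono[OF bdd_above_dual[OF \<phi>]]) (auto simp: unit_sphere_def unit_ball_def)
  ultimately obtain x where x: "x \<in> unit_sphere X" "\<phi> x0 \<le> \<phi> x"
      "\<And>u. u \<in> unit_sphere X \<Longrightarrow> \<phi> u \<le> \<phi> x + \<epsilon> * dist u x"
    using ekeland_maximum[of "unit_sphere X" \<phi> x0 \<epsilon>] x0(1) \<open>\<epsilon> > 0\<close> by metis
  have xb: "norm x = 1" "x \<in> X" "norm z = 1"
    using x(1) z by (auto simp: unit_sphere_def)
  have "\<phi> x \<ge> 0" using x0 x by linarith
  obtain k where k: "k \<ge> 0"
      "\<And>y. overlap z y \<le> e / 4 + k * overlap x y + (norm y - sign_pairing x y)"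
    using overlap_le[of "e / 4" z x] \<open>e > 0\<close> by auto
  (* The first bound keeps the overlap of y with z, at most e/4 + (k + 1) \<delta>, below e/2; the second
     one keeps the relative loss 3 \<delta> \<phi> x in \<phi> y below \<alpha>/2. *)
  define \<delta> where "\<delta> = min (e / (4 * (2 * k + 3))) (\<alpha> / (6 * (\<phi> x + 1)))"
  have "\<delta> > 0" using \<open>e > 0\<close> \<open>\<alpha> > 0\<close> \<open>k \<ge> 0\<close> \<open>\<phi> x \<ge> 0\<close> by (simp add: \<delta>_def)
  have d1: "\<delta> * (4 * (2 * k + 3)) \<le> e" and d2: "\<delta> * (6 * (\<phi> x + 1)) \<le> \<alpha>"
    using k(1) \<open>\<phi> x \<ge> 0\<close> by (simp_all add: \<delta>_def pos_le_divide_eq[symmetric])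
  obtain y where y: "y \<in> X" "norm y \<le> 1" "sign_pairing x y > 1 - \<delta>" "norm (x - y) > 2 - \<delta>"
    using D_point_opposite[OF _ \<open>\<delta> > 0\<close>] D x(1) unfolding property_D_def by blast
  have "\<phi> y \<ge> (1 - 3 * \<delta>) * \<phi> x - 2 * \<epsilon>"
    using \<open>\<epsilon> > 0\<close>
    by (intro functional_ge_of_aligned[OF X(1) \<phi> x(1) \<open>\<phi> x \<ge> 0\<close> _ x(3) y(1-3) \<open>\<delta> > 0\<close>]) auto
  then have "\<phi> y > m - \<alpha>"
    using d2 x0 x(2) \<open>\<delta> > 0\<close> by (simp add: \<epsilon>_def algebra_simps)
  then have "y \<in> slice X \<phi> \<alpha>"
    using y by (simp add: slice_def unit_ball_def m_def)
  moreover have "norm (z - y) > 2 - e"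
  proof -
    have ny: "norm y > 1 - \<delta>"
      using y(3) abs_sign_pairing_le[of x y] by linarith
    have "norm (x + y) > 2 - \<delta>"
      using abs_sign_pairing_le[of x "x + y"] y(3) xb by (simp add: sign_pairing_add sign_pairing_self)
    then have "overlap x y \<le> \<delta>"
      using norm_add_norm_diff_le_overlap[of x y] y xb by linarith
    then have "k * overlap x y \<le> k * \<delta>" using k(1) by (rule mult_left_mono)
    then have "overlap z y \<le> e / 4 + k * \<delta> + \<delta>"
      using k(2)[of y] y by linarith
    also have "\<dots> < (e - \<delta>) / 2"
      using d1 \<open>e > 0\<close> by (simp add: algebra_simps)
    finally have "2 * overlap z y < e - \<delta>" by simp
    moreover have "norm (z - y) > 2 - \<delta> - 2 * overlap z y"
      using norm_diff_ge_overlap[of z y] ny unfolding xb by linarith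
    ultimately show ?thesis by linarith
  qed
  ultimately show thesis by (rule that)
qed

theorem theorem4p12:
  fixes X :: "L1 set"
  assumes "subspace X" and "closed X"
  shows "property_D X \<longleftrightarrow> Daugavet_property X"
proof
  assume "Daugavet_property X"
  then show "property_D X"
    by (auto simp: property_D_def Daugavet_property_def D_point_def Daugavet_point_def
        supporting_functionals_def)
next
  assume D: "property_D X"
  have "(SUP y\<in>slice X \<phi> \<alpha>. norm (z - y)) = 2"
    if z: "z \<in> unit_sphere X" and \<phi>: "\<phi> \<in> dual X" and "\<alpha> > 0" for z \<phi> \<alpha>
  proof (rule cSup_eq_non_empty)
    note opposite = opposite_point_in_slice[OF assms D z \<phi> \<open>\<alpha> > 0\<close>]
    show "(\<lambda>y. norm (z - y)) ` slice X \<phi> \<alpha> \<noteq> {}"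
      using opposite[of 1] by auto
    show "d \<le> 2" if "d \<in> (\<lambda>y. norm (z - y)) ` slice X \<phi> \<alpha>" for d
    proof -
      obtain y where "d = norm (z - y)" "norm y \<le> 1"
        using \<open>d \<in> _\<close> by (auto simp: slice_def unit_ball_def)
      then show ?thesis
        using norm_triangle_ineq4[of z y] z by (simp add: unit_sphere_def)
    qed
    show "2 \<le> b" if b: "\<And>d. d \<in> (\<lambda>y. norm (z - y)) ` slice X \<phi> \<alpha> \<Longrightarrow> d \<le> b" for b
    proof (rule ccontr)
      assume "\<not> 2 \<le> b"
      then obtain y where "y \<in> slice X \<phi> \<alpha>" "norm (z - y) > 2 - (2 - b)"
        using opposite[of "2 - b"] by auto
      then show False using b by fastforce
    qed
  qed
  then show "Daugavet_property X"
    by (simp add: Daugavet_property_def Daugavet_point_def)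
qed

end
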